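(* Let $\mathcal{U}$ and $\mathcal{Y}$ be real Hilbert spaces. The following (scalar-valued) symmetric positive semidefinite kernels $k: \mathcal{U}\times\mathcal{U}\to\mathbb{R}$ are nonexpansive: (1) The bilinear kernel $k(u,v)=\langle u,v\rangle_{\mathcal{U}}$. (2) The Gaussian kernel $k(u,v)=e^{-\|u-v\|_{\mathcal{U}}^2/\sigma^2}$ whenever $\sigma \geq \sqrt{2}$. (3) The scaled Laplacian kernel $k(u,v) = (1+\|u-v\|_{\mathcal{U}})\, e^{-\|u-v\|_{\mathcal{U}}}$. (4) The kernel $k(u,v) = (c+\|u-v\|_{\mathcal{U}}^2)^{-d}$, where $c\geq 0$ and $d>0$ are reals satisfying $2d\leq c^{d+1}$. In addition, $K:\mathcal{U}\times\mathcal{U}\to\mathcal{B}(\mathcal{Y})$ is both symmetric positive semidefinite and nonexpansive in each of the following cases: (5) $K(u,v)=k(u,v)R$, where $k:\mathcal{U}\times\mathcal{U}\to\mathbb{R}$ is a symmetric positive semidefinite and nonexpansive kernel, and $R\in\mathcal{B}(\mathcal{Y})$ is self-adjoint and positive with $\|R\|_{\mathcal{B}(\mathcal{Y})}\leq 1$. (6) $K(u,v)=\sum_{i=1}^r \alpha_i K_i(u,v)$, where $K_i:\mathcal{U}\times\mathcal{U}\to\mathcal{B}(\mathcal{Y})$ is nonexpansive and symmetric positive semidefinite and $\alpha_i\geq 0$ for all $i=1,2,\dots,r$, and $\sum_{i=1}^r\alpha_i\leq 1$. (7) $K(u,v)=R\,L(u,v)\,R^*$, where $L:\mathcal{U}\times\mathcal{U}\to\mathbb{R}$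 is a symmetric positive semidefinite and nonexpansive kernel, and $R\in\mathcal{B}(\mathcal{Y})$ satisfies $\|R\|_{\mathcal{B}(\mathcal{Y})}\leq 1$.
   Context: $\mathcal{B}(\mathcal{Y})$ denotes the bounded linear operators on $\mathcal{Y}$ with operator norm $\|\cdot\|_{\mathcal{B}(\mathcal{Y})}$, and $R^*$ is the adjoint of $R$. An operator $R\in\mathcal{B}(\mathcal{Y})$ is positive if $\langle y,Ry\rangle_{\mathcal{Y}}\geq 0$ for all $y\in\mathcal{Y}$. A mapping $K:\mathcal{U}\times\mathcal{U}\to\mathcal{B}(\mathcal{Y})$ is symmetric if $K(u,v)^*=K(v,u)$ for all $u,v\in\mathcal{U}$; it is positive semidefinite if $\sum_{i=1}^n\sum_{j=1}^n\langle y_i,K(u_i,u_j)y_j\rangle_{\mathcal{Y}}\geq 0$ for all $n\in\mathbb{N}$, $u_1,\dots,u_n\in\mathcal{U}$ and $y_1,\dots,y_n\in\mathcal{Y}$; and it is nonexpansive if for all $u,v\in\mathcal{U}$ $$\|K(u,u)-K(u,v)-K(v,u)+K(v,v)\|_{\mathcal{B}(\mathcal{Y})}^{\frac12}\leq\|u-v\|_{\mathcal{U}}.$$ For scalar-valued kernels $k:\mathcal{U}\times\mathcal{U}\to\mathbb{R}$ the same definitions apply with $\mathcal{Y}=\mathbb{R}$ and $\mathcal{B}(\mathbb{R})$ identified with $\mathbb{R}$ (operator norm equal to absolute value). In (7), the real number $L(u,v)$ acts on $\mathcal{Y}$ by scalar multiplication, so that $R\,L(u,v)\,R^* = L(u,v)\,RR^*$.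 *)

theory Defs
  imports "HOL-Analysis.Analysis"
begin

definition adj_blinfun :: "('a::real_inner \<Rightarrow>\<^sub>L 'b::real_inner) \<Rightarrow> ('b \<Rightarrow>\<^sub>L 'a)" where
  "adj_blinfun R = Blinfun (adjoint (blinfun_apply R))"

text \<open>
  Both the choice in \<^const>\<open>adjoint\<close> and the coercion \<^const>\<open>Blinfun\<close> are junk unless the adjoint exists
  and is bounded. On Hilbert spaces this follows from the Riesz representation theorem, so that
  \<^const>\<open>adj_blinfun\<close> is the Hilbert space adjoint (theorem \<open>inner_adj_blinfun\<close> below).
\<close>

lemma riesz_representation:
  fixes f :: "'a::{real_inner, complete_space} \<Rightarrow> real"
  assumes "bounded_linear f"
  shows "\<exists>w. \<forall>x. f x = x \<bullet> w"
proof -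
  interpret f: bounded_linear f by fact
  obtain B where B: "\<And>x. norm (f x) \<le> norm x * B" "B > 0"
    using f.pos_bounded by blast
  define J where "J x = (x \<bullet> x) / 2 - f x" for x
  have lower: "J x \<ge> - (B\<^sup>2) / 2" for x
  proof -
    have "0 \<le> (norm x - B)\<^sup>2" by simp
    also have "\<dots> = norm x ^ 2 - 2 * (norm x * B) + B\<^sup>2"
      by (simp add: power2_diff)
    also have "\<dots> \<le> norm x ^ 2 - 2 * f x + B\<^sup>2"
      using B(1)[of x] by auto
    finally show ?thesis
      by (simp add: J_def power2_norm_eq_inner)
  qed
  define m where "m = (INF x. J x)"
  have bdd: "bdd_below (range J)"
    using lower by (auto intro!: bdd_belowI)
  have m_le: "m \<le> J x" for x
    unfolding m_def by (rule cINF_lower[OF bdd]) simp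
  have "\<exists>x. J x < m + inverse (real (Suc n))" for n
    using cInf_lessD[of "range J" "m + inverse (real (Suc n))"]
    by (auto simp: m_def)
  then obtain X where X: "\<And>n. J (X n) < m + inverse (real (Suc n))"
    by metis
  have par: "J x + J y - 2 * J ((1/2) *\<^sub>R (x + y)) = (norm (x - y))\<^sup>2 / 4" for x y
    by (simp add: J_def f.add f.scaleR power2_norm_eq_inner inner_add inner_diff
        inner_commute algebra_simps field_simps)
  have dist: "(norm (X i - X j))\<^sup>2 \<le> 4 * (inverse (real (Suc i)) + inverse (real (Suc j)))" for i j
    using par[of "X i" "X j"] m_le[of "(1/2) *\<^sub>R (X i + X j)"] X[of i] X[of j] by argo
  have "Cauchy X"
  proof (rule CauchyI)
    fix e :: real assume e: "e > 0"
    obtain N where N: "inverse (real (Suc N)) < e\<^sup>2 / 8"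
      using reals_Archimedean[of "e\<^sup>2 / 8"] e by auto
    have "norm (X i - X j) < e" if "i \<ge> N" "j \<ge> N" for i j
    proof -
      have "inverse (real (Suc i)) \<le> inverse (real (Suc N))"
           "inverse (real (Suc j)) \<le> inverse (real (Suc N))"
        using that by (auto intro!: le_imp_inverse_le)
      then have "(norm (X i - X j))\<^sup>2 < e\<^sup>2"
        using dist[of i j] N by argo
      then show ?thesis
        using e by (meson less_imp_le power2_less_imp_less)
    qed
    then show "\<exists>M. \<forall>i\<ge>M. \<forall>j\<ge>M. norm (X i - X j) < e" by blast
  qed
  then obtain w where w: "X \<longlonglongrightarrow> w"
    using Cauchy_convergent convergent_def by blast
  have "(\<lambda>n. J (X n)) \<longlonglongrightarrow> J w"
    unfolding J_def by (intro tendsto_intros f.tendsto w) auto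
  moreover have "(\<lambda>n. m + inverse (real (Suc n))) \<longlonglongrightarrow> m + 0"
    by (intro tendsto_intros LIMSEQ_inverse_real_of_nat)
  ultimately have Jw: "J w \<le> m"
    using LIMSEQ_le[of "\<lambda>n. J (X n)" "J w" "\<lambda>n. m + inverse (real (Suc n))" m] X
    by (auto intro: less_imp_le)
  have "f h = h \<bullet> w" for h
  proof -
    define a where "a = h \<bullet> w - f h"
    define q where "q = (h \<bullet> h) + 1"
    have q: "q > 0" unfolding q_def by (rule add_nonneg_pos) auto
    have J_line: "J (w + t *\<^sub>R h) = J w + t * a + t\<^sup>2 * (h \<bullet> h) / 2" for t
      by (simp add: J_def a_def f.add f.scaleR inner_add inner_commute
          power2_eq_square algebra_simps)
    have "0 \<le> (- a / q) * a + (- a / q)\<^sup>2 * (h \<bullet> h) / 2"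
      using J_line[of "- a / q"] m_le[of "w + (- a / q) *\<^sub>R h"] Jw by linarith
    moreover have "(- a / q) * a = - ((a / q)\<^sup>2 * q)"
      using q by (simp add: power2_eq_square)
    ultimately have "(a / q)\<^sup>2 * ((h \<bullet> h) / 2 + 1) \<le> 0"
      by (simp add: q_def distrib_left)
    moreover have "(h \<bullet> h) / 2 + 1 > 0" 
      by (rule add_nonneg_pos) auto
    ultimately have "a / q = 0"
      using mult_pos_pos[of "(a / q)\<^sup>2" "(h \<bullet> h) / 2 + 1"] zero_less_power2[of "a / q"] by linarith
    then show ?thesis using q by (simp add: a_def)
  qed
  then show ?thesis by blast
qed

theorem inner_adj_blinfun:
  fixes R :: "'a::{real_inner, complete_space} \<Rightarrow>\<^sub>L 'b::real_inner"
  shows "blinfun_apply R x \<bullet> y = x \<bullet> blinfun_apply (adj_blinfun R) y"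
proof -
  have "\<exists>w. \<forall>x. blinfun_apply R x \<bullet> y = x \<bullet> w" for y
    by (rule riesz_representation)
       (intro bounded_linear_compose[OF bounded_linear_inner_left] blinfun.bounded_linear_right)
  then obtain g where g: "\<And>x y. blinfun_apply R x \<bullet> y = x \<bullet> g y" by metis
  have "bounded_linear g"
  proof (rule bounded_linear_intro[where K = "norm R"])
    fix y z show "g (y + z) = g y + g z"
      by (subst vector_eq_ldot[symmetric]) (simp add: g[symmetric] inner_add_right)
  next
    fix r y show "g (r *\<^sub>R y) = r *\<^sub>R g y"
      by (subst vector_eq_ldot[symmetric]) (simp add: g[symmetric])
  next
    fix y
    have "norm (g y) * norm (g y) = blinfun_apply R (g y) \<bullet> y"
      by (simp add: g power2_norm_eq_inner[symmetric] power2_eq_square)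
    also have "\<dots> \<le> norm (blinfun_apply R (g y)) * norm y" by (rule norm_cauchy_schwarz)
    also have "\<dots> \<le> (norm R * norm (g y)) * norm y"
      by (intro mult_right_mono norm_blinfun) auto
    finally show "norm (g y) \<le> norm y * norm R"
      by (cases "g y = 0") (auto simp: mult.commute mult.left_commute)
  qed
  moreover have "adjoint (blinfun_apply R) = g"
    by (rule adjoint_unique) (simp add: g)
  ultimately show ?thesis
    by (simp add: adj_blinfun_def bounded_linear_Blinfun_apply g)
qed

definition positive_op :: "('y::real_inner \<Rightarrow>\<^sub>L 'y) \<Rightarrow> bool" where
  "positive_op R \<longleftrightarrow> (\<forall>y. y \<bullet> blinfun_apply R y \<ge> 0)"

definition symmetric_kernel :: "('u \<Rightarrow> 'u \<Rightarrow> 'y::real_inner \<Rightarrow>\<^sub>L 'y) \<Rightarrow> bool" where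
  "symmetric_kernel K \<longleftrightarrow> (\<forall>u v. adj_blinfun (K u v) = K v u)"

definition psd_kernel :: "('u \<Rightarrow> 'u \<Rightarrow> 'y::real_inner \<Rightarrow>\<^sub>L 'y) \<Rightarrow> bool" where
  "psd_kernel K \<longleftrightarrow> (\<forall>(n::nat) (u :: nat \<Rightarrow> 'u) (y :: nat \<Rightarrow> 'y).
     (\<Sum>i=1..n. \<Sum>j=1..n. y i \<bullet> blinfun_apply (K (u i) (u j)) (y j)) \<ge> 0)"

definition nonexpansive_kernel ::
    "('u::real_normed_vector \<Rightarrow> 'u \<Rightarrow> 'y::real_inner \<Rightarrow>\<^sub>L 'y) \<Rightarrow> bool" where
  "nonexpansive_kernel K \<longleftrightarrow>
     (\<forall>u v. sqrt (norm (K u u - K u v - K v u + K v v)) \<le> norm (u - v))"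

text \<open>
  \<open>scalar_op c\<close> is multiplication by \<open>c\<close>. At type \<^typ>\<open>real\<close> it is the identification of the real
  numbers with the bounded operators on them, through which the notions above apply to
  scalar-valued kernels; the lemmas below spell out the result.
\<close>

definition scalar_op :: "real \<Rightarrow> ('y::real_normed_vector \<Rightarrow>\<^sub>L 'y)" where
  "scalar_op c = c *\<^sub>R id_blinfun"

definition scalar_kernel :: "('u \<Rightarrow> 'u \<Rightarrow> real) \<Rightarrow> 'u \<Rightarrow> 'u \<Rightarrow> (real \<Rightarrow>\<^sub>L real)" where
  "scalar_kernel k = (\<lambda>u v. scalar_op (k u v))"

lemma scalar_op_apply [simp]: "blinfun_apply (scalar_op c) y = c *\<^sub>R y"
  by (simp add: scalar_op_def blinfun.scaleR_left)

lemma symmetric_scalar_kernel_iff: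
  "symmetric_kernel (scalar_kernel k) \<longleftrightarrow> (\<forall>u v. k u v = k v u)"
proof -
  have "adj_blinfun (scalar_op c) = (scalar_op c :: real \<Rightarrow>\<^sub>L real)" for c
  proof -
    have "adjoint (blinfun_apply (scalar_op c :: real \<Rightarrow>\<^sub>L real)) = blinfun_apply (scalar_op c)"
      by (rule adjoint_unique) simp
    then show ?thesis by (simp add: adj_blinfun_def blinfun_apply_inverse)
  qed
  moreover have "scalar_op c = (scalar_op d :: real \<Rightarrow>\<^sub>L real) \<longleftrightarrow> c = d" for c d
    by (metis scalar_op_apply mult.right_neutral real_scaleR_def)
  ultimately show ?thesis
    by (auto simp: symmetric_kernel_def scalar_kernel_def)
qed

lemma psd_scalar_kernel_iff:
  "psd_kernel (scalar_kernel k) \<longleftrightarrow> (\<forall>(n::nat) u (y :: nat \<Rightarrow> real).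
     (\<Sum>i=1..n. \<Sum>j=1..n. y i * k (u i) (u j) * y j) \<ge> 0)"
  by (simp add: psd_kernel_def scalar_kernel_def mult.assoc)

lemma nonexpansive_scalar_kernel_iff:
  "nonexpansive_kernel (scalar_kernel k) \<longleftrightarrow>
     (\<forall>u v. sqrt \<bar>k u u - k u v - k v u + k v v\<bar> \<le> norm (u - v))"
proof -
  have "scalar_op a - scalar_op b - scalar_op c + scalar_op d
      = (a - b - c + d) *\<^sub>R (id_blinfun :: real \<Rightarrow>\<^sub>L real)" for a b c d
    by (simp add: scalar_op_def scaleR_diff_left scaleR_add_left)
  then show ?thesis
    by (simp add: nonexpansive_kernel_def scalar_kernel_def norm_blinfun_id)
qed

end

theory Submission
  imports Defs
begin

text \<open>
  The Gaussian, the scaled Laplacian and the power kernel are functions of \<open>norm (u - v)\<close>. Each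
  is positive semidefinite because it is a mixture of Gaussians \<open>exp (- s * (norm (u - v))\<^sup>2)\<close>,
  \<open>s \<ge> 0\<close>, with nonnegative weights, in whatever dimension. For the power
  \<open>(c + (norm (u - v))\<^sup>2) powr (- d)\<close> the mixture is the Gamma integral (\<open>powr_mixture\<close>); for
  \<open>(1 + norm (u - v)) * exp (- norm (u - v))\<close> it is an integral evaluated through an explicit
  antiderivative in terms of a primitive of \<open>exp (- x\<^sup>2)\<close> (\<open>matern_mixture\<close>).

  A Gaussian is \<open>a u * exp (2 * s * (u \<bullet> v)) * a v\<close> with \<open>a u = exp (- s * (norm u)\<^sup>2)\<close>, and the
  exponential of a symmetric positive semidefinite kernel is again positive semidefinite by the
  Schur product theorem (\<open>psd_on_mult\<close>) and the exponential series. The Schur product theorem comes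
  from a factorization of a symmetric positive semidefinite matrix into rank-one terms
  (\<open>psd_on_factorization\<close>). The same factorization writes the quadratic form of \<open>k(u, v) R\<close>
  as a sum of terms \<open>w \<bullet> R w\<close>, and \<open>R L(u, v) R\<^sup>*\<close> is the kernel \<open>L(u, v) S\<close> with
  \<open>S = R R\<^sup>*\<close>.

  For a radial kernel with profile \<open>\<phi>\<close>, nonexpansiveness is the scalar inequality
  \<open>2 * \<bar>\<phi> 0 - \<phi> r\<bar> \<le> r\<^sup>2\<close> for \<open>r \<ge> 0\<close>, which is elementary calculus in each case. For the
  operator-valued kernels it follows from submultiplicativity of the norm and the triangle
  inequality.
\<close>

section \<open>Positive semidefinite matrices over finite index sets\<close>

text \<open>
  The matrix \<open>A\<close>, restricted to the rows and columns in \<open>I\<close>, has a nonnegative quadratic form.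
  Symmetry is not included and is assumed separately where it is needed. The definition is of
  interest for finite \<open>I\<close> only, since infinite sums are zero.
\<close>

definition psd_on :: "'i set \<Rightarrow> ('i \<Rightarrow> 'i \<Rightarrow> real) \<Rightarrow> bool" where
  "psd_on I A \<longleftrightarrow> (\<forall>x. 0 \<le> (\<Sum>i\<in>I. \<Sum>j\<in>I. x i * A i j * x j))"

lemma psd_onI: "(\<And>x. 0 \<le> (\<Sum>i\<in>I. \<Sum>j\<in>I. x i * A i j * x j)) \<Longrightarrow> psd_on I A"
  by (simp add: psd_on_def)

lemma psd_onD: "psd_on I A \<Longrightarrow> 0 \<le> (\<Sum>i\<in>I. \<Sum>j\<in>I. x i * A i j * x j)"
  by (simp add: psd_on_def)

lemma psd_on_subset:
  assumes "psd_on I A" "J \<subseteq> I" "finite I"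
  shows "psd_on J A"
proof (rule psd_onI)
  fix x :: "'a \<Rightarrow> real"
  define y where "y i = (if i \<in> J then x i else 0)" for i
  have inner: "(\<Sum>j\<in>I. y i * A i j * y j) = (\<Sum>j\<in>J. y i * A i j * x j)" for i
    using assms by (intro sum.mono_neutral_cong_right) (auto simp: y_def)
  have "(\<Sum>i\<in>I. \<Sum>j\<in>I. y i * A i j * y j) = (\<Sum>i\<in>J. \<Sum>j\<in>J. x i * A i j * x j)"
    unfolding inner using assms finite_subset[of J I]
    by (intro sum.mono_neutral_cong_right) (auto simp: y_def)
  then show "0 \<le> (\<Sum>i\<in>J. \<Sum>j\<in>J. x i * A i j * x j)"
    using psd_onD[OF assms(1), of y] by simp
qed

lemma psd_on_zero_diagonal:
  assumes "psd_on I A" "finite I" "p \<in> I" "j \<in> I" "A p p = 0" "A j p = A p j"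
  shows "A p j = 0"
proof (rule ccontr)
  assume nz: "A p j \<noteq> 0"
  then have "p \<noteq> j" using assms by auto
  have "psd_on {p, j} A"
    by (rule psd_on_subset[OF assms(1)]) (use assms(2-4) in auto)
  \<comment> \<open>the quadratic form is affine in the \<open>p\<close>-th coordinate \<open>t\<close>; this value makes it \<open>- 1\<close>\<close>
  define t where "t = - (A j j + 1) / (2 * A p j)"
  have "(\<Sum>i\<in>{p, j}. \<Sum>k\<in>{p, j}. (if i = p then t else 1) * A i k * (if k = p then t else 1))
      = t * A p p * t + t * A p j + A j p * t + A j j"
    using \<open>p \<noteq> j\<close> by simp
  also have "\<dots> = A j j + 2 * t * A p j"
    by (simp only: assms(5,6)) simp
  also have "\<dots> = -1" using nz by (simp add: t_def field_simps)
  finally show False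
    using psd_onD[OF \<open>psd_on {p, j} A\<close>, of "\<lambda>i. if i = p then t else 1"] by simp
qed

text \<open>
  Elimination of the index \<open>p\<close>: minimizing the quadratic form over the \<open>p\<close>-th coordinate leaves
  the quadratic form of the Schur complement. If \<open>A p p = 0\<close>, then division by zero makes the
  complement \<open>A\<close> itself, and the statement remains true.
\<close>

lemma psd_on_schur_complement:
  assumes A: "psd_on (insert p I) A" and "finite I" "p \<notin> I"
    and sym: "\<And>i. i \<in> I \<Longrightarrow> A i p = A p i"
  shows "psd_on I (\<lambda>i j. A i j - A i p * A p j / A p p)"
proof (rule psd_onI)
  fix x :: "'a \<Rightarrow> real"
  define b where "b = (\<Sum>j\<in>I. A p j * x j)"
  \<comment> \<open>the minimizing value of the \<open>p\<close>-th coordinate\<close>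
  define t where "t = - b / A p p"
  define y where "y = x(p := t)"
  have yI: "y i = x i" if "i \<in> I" for i using that assms by (auto simp: y_def)
  have yp: "y p = t" by (simp add: y_def)
  have b': "(\<Sum>i\<in>I. x i * A i p) = b"
    unfolding b_def by (intro sum.cong) (auto simp: sym)
  have "(\<Sum>i\<in>insert p I. \<Sum>j\<in>insert p I. y i * A i j * y j)
      = t * A p p * t + (\<Sum>j\<in>I. t * A p j * x j) + (\<Sum>i\<in>I. x i * A i p * t)
        + (\<Sum>i\<in>I. \<Sum>j\<in>I. x i * A i j * x j)"
    using assms by (simp add: yI yp sum.distrib cong: sum.cong)
  also have "(\<Sum>j\<in>I. t * A p j * x j) = t * b"
    by (simp add: b_def sum_distrib_left mult.assoc)
  also have "(\<Sum>i\<in>I. x i * A i p * t) = b * t"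
    by (simp add: b'[symmetric] sum_distrib_right)
  also have "t * A p p * t + t * b + b * t = - b * b / A p p"
    by (cases "A p p = 0") (auto simp: t_def field_simps)
  also have "- b * b / A p p = - (\<Sum>i\<in>I. \<Sum>j\<in>I. x i * (A i p * A p j / A p p) * x j)"
  proof -
    have "b * b / A p p = (\<Sum>i\<in>I. x i * A i p) * (\<Sum>j\<in>I. A p j * x j) / A p p"
      by (simp add: b' b_def)
    also have "\<dots> = (\<Sum>i\<in>I. \<Sum>j\<in>I. x i * (A i p * A p j / A p p) * x j)"
      by (simp add: sum_product sum_divide_distrib mult.assoc)
    finally show ?thesis by simp
  qed
  finally show "0 \<le> (\<Sum>i\<in>I. \<Sum>j\<in>I. x i * (A i j - A i p * A p j / A p p) * x j)"
    using psd_onD[OF A, of y] by (simp add: algebra_simps sum_subtractf)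
qed

text \<open>
  A symmetric positive semidefinite matrix is a sum of rank-one matrices, by a Cholesky
  factorization that adds one index at a time.
\<close>

lemma psd_on_factorization:
  assumes "finite I" "psd_on I A" "\<And>i j. i \<in> I \<Longrightarrow> j \<in> I \<Longrightarrow> A i j = A j i"
  shows "\<exists>f. \<forall>i\<in>I. \<forall>j\<in>I. A i j = (\<Sum>m\<in>I. f m i * f m j)"
  using assms
proof (induction I arbitrary: A rule: finite_induct)
  case empty
  then show ?case by simp
next
  case (insert p I)
  note psd = insert.prems(1) and sym = insert.prems(2)
  define B where "B i j = A i j - A i p * A p j / A p p" for i j
  have "psd_on I B"
    unfolding B_def by (rule psd_on_schur_complement[OF psd insert.hyps sym]) auto
  moreover have "B i j = B j i" if "i \<in> I" "j \<in> I" for i j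
    using that sym[of i j] sym[of i p] sym[of j p] by (simp add: B_def)
  ultimately obtain f where f: "\<And>i j. i \<in> I \<Longrightarrow> j \<in> I \<Longrightarrow> B i j = (\<Sum>m\<in>I. f m i * f m j)"
    using insert.IH[of B] by blast
  define g where "g m i = (if m = p then A i p / sqrt (A p p) else if i = p then 0 else f m i)"
    for m i
  have "psd_on {p} A"
    by (rule psd_on_subset[OF psd]) (use insert.hyps in auto)
  from psd_onD[OF this, of "\<lambda>_. 1"] have App: "0 \<le> A p p" by simp
  have zero: "A i p = 0" if "A p p = 0" "i \<in> insert p I" for i
    using psd_on_zero_diagonal[OF psd _ _ that(2) that(1)] that sym[of i p] insert.hyps by auto
  have row: "A i p * A p j / A p p = A i j"
    if "i = p \<or> j = p" "i \<in> insert p I" "j \<in> insert p I" for i j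
    using that zero[of i] zero[of j] sym[of p j] sym[of p i] by (cases "A p p = 0") auto
  have gp: "g p i * g p j = A i p * A p j / A p p" if "j \<in> insert p I" for i j
    using App sym[of j p] that by (simp add: g_def)
  have factor: "A i j = (\<Sum>m\<in>insert p I. g m i * g m j)" if i: "i \<in> insert p I" and j: "j \<in> insert p I" for i j
  proof (cases "i = p \<or> j = p")
    case True
    then have "(\<Sum>m\<in>I. g m i * g m j) = 0"
      using insert.hyps by (intro sum.neutral) (auto simp: g_def)
    then show ?thesis using insert.hyps gp[OF j, of i] row[OF True i j] by simp
  next
    case False
    then have "(\<Sum>m\<in>I. g m i * g m j) = (\<Sum>m\<in>I. f m i * f m j)"
      using insert.hyps by (intro sum.cong) (auto simp: g_def)
    also have "\<dots> = B i j" using False i j by (intro f[symmetric]) auto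
    finally show ?thesis using insert.hyps gp[OF j, of i] by (simp add: B_def)
  qed
  show ?case by (intro exI[of _ g] ballI factor)
qed

lemma psd_on_scale:
  assumes "psd_on I A"
  shows "psd_on I (\<lambda>i j. c i * A i j * c j)"
proof (rule psd_onI)
  fix x
  show "0 \<le> (\<Sum>i\<in>I. \<Sum>j\<in>I. x i * (c i * A i j * c j) * x j)"
    using psd_onD[OF assms, of "\<lambda>i. x i * c i"] by (simp add: ac_simps)
qed

lemma psd_on_cmult:
  assumes "psd_on I A" "0 \<le> c"
  shows "psd_on I (\<lambda>i j. c * A i j)"
proof (rule psd_onI)
  fix x
  have "(\<Sum>i\<in>I. \<Sum>j\<in>I. x i * (c * A i j) * x j) = c * (\<Sum>i\<in>I. \<Sum>j\<in>I. x i * A i j * x j)"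
    by (simp add: sum_distrib_left mult_ac)
  then show "0 \<le> (\<Sum>i\<in>I. \<Sum>j\<in>I. x i * (c * A i j) * x j)"
    using psd_onD[OF assms(1), of x] assms(2) by simp
qed

lemma psd_on_sum:
  assumes "\<And>m. m \<in> M \<Longrightarrow> psd_on I (A m)"
  shows "psd_on I (\<lambda>i j. \<Sum>m\<in>M. A m i j)"
proof (rule psd_onI)
  fix x
  have "0 \<le> (\<Sum>m\<in>M. \<Sum>i\<in>I. \<Sum>j\<in>I. x i * A m i j * x j)"
    using assms by (intro sum_nonneg psd_onD)
  also have "\<dots> = (\<Sum>i\<in>I. \<Sum>m\<in>M. \<Sum>j\<in>I. x i * A m i j * x j)" by (rule sum.swap)
  also have "\<dots> = (\<Sum>i\<in>I. \<Sum>j\<in>I. \<Sum>m\<in>M. x i * A m i j * x j)"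
    by (intro sum.cong refl sum.swap)
  finally show "0 \<le> (\<Sum>i\<in>I. \<Sum>j\<in>I. x i * (\<Sum>m\<in>M. A m i j) * x j)"
    by (simp add: sum_distrib_left sum_distrib_right)
qed

lemma psd_on_cong:
  assumes "\<And>i j. i \<in> I \<Longrightarrow> j \<in> I \<Longrightarrow> A i j = B i j"
  shows "psd_on I A \<longleftrightarrow> psd_on I B"
  unfolding psd_on_def using assms by (simp cong: sum.cong)

text \<open>The Schur product theorem; symmetry is needed for one of the factors only.\<close>

lemma psd_on_mult:
  assumes "finite I" "psd_on I A" "\<And>i j. i \<in> I \<Longrightarrow> j \<in> I \<Longrightarrow> A i j = A j i" "psd_on I B"
  shows "psd_on I (\<lambda>i j. A i j * B i j)"
proof -
  obtain f where f: "\<And>i j. i \<in> I \<Longrightarrow> j \<in> I \<Longrightarrow> A i j = (\<Sum>m\<in>I. f m i * f m j)"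
    using psd_on_factorization[OF assms(1-3)] by blast
  have "A i j * B i j = (\<Sum>m\<in>I. f m i * B i j * f m j)" if "i \<in> I" "j \<in> I" for i j
    unfolding f[OF that] sum_distrib_right by (intro sum.cong refl) (simp add: mult_ac)
  then show ?thesis
    by (subst psd_on_cong) (auto intro!: psd_on_sum psd_on_scale assms)
qed

lemma psd_on_LIMSEQ:
  assumes "\<And>n::nat. psd_on I (A n)" "\<And>i j. i \<in> I \<Longrightarrow> j \<in> I \<Longrightarrow> (\<lambda>n. A n i j) \<longlonglongrightarrow> B i j"
  shows "psd_on I B"
proof (rule psd_onI)
  fix x
  have "(\<lambda>n. \<Sum>i\<in>I. \<Sum>j\<in>I. x i * A n i j * x j) \<longlonglongrightarrow> (\<Sum>i\<in>I. \<Sum>j\<in>I. x i * B i j * x j)"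
    by (intro tendsto_intros assms)
  then show "0 \<le> (\<Sum>i\<in>I. \<Sum>j\<in>I. x i * B i j * x j)"
    by (rule LIMSEQ_le_const) (use assms(1) in \<open>auto intro: psd_onD\<close>)
qed

lemma psd_on_exp:
  assumes "finite I" "psd_on I A" "\<And>i j. i \<in> I \<Longrightarrow> j \<in> I \<Longrightarrow> A i j = A j i"
  shows "psd_on I (\<lambda>i j. exp (A i j))"
proof -
  have pow: "psd_on I (\<lambda>i j. A i j ^ m)" for m
  proof (induction m)
    case 0
    have "0 \<le> (\<Sum>i\<in>I. \<Sum>j\<in>I. x i * x j)" for x :: "'a \<Rightarrow> real"
      unfolding sum_product[symmetric] by simp
    then show ?case by (simp add: psd_on_def)
  next
    case (Suc m)
    then show ?case using psd_on_mult[OF assms] by simp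
  qed
  show ?thesis
  proof (rule psd_on_LIMSEQ)
    show "psd_on I (\<lambda>i j. \<Sum>m<n. inverse (fact m) * A i j ^ m)" for n
      by (intro psd_on_sum psd_on_cmult pow) auto
    show "(\<lambda>n. \<Sum>m<n. inverse (fact m) * A i j ^ m) \<longlonglongrightarrow> exp (A i j)" for i j
      using exp_converges[of "A i j"] by (simp add: sums_def)
  qed
qed

section \<open>Gaussians and their mixtures\<close>

lemma psd_on_inner:
  fixes u :: "'i \<Rightarrow> 'u::real_inner"
  shows "psd_on I (\<lambda>i j. u i \<bullet> u j)"
proof (rule psd_onI)
  fix x
  define w where "w = (\<Sum>j\<in>I. x j *\<^sub>R u j)"
  have "0 \<le> w \<bullet> w" by simp
  also have "w \<bullet> w = (\<Sum>i\<in>I. x i *\<^sub>R u i \<bullet> w)"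
    by (subst (1) w_def) (rule inner_sum_left)
  also have "\<dots> = (\<Sum>i\<in>I. \<Sum>j\<in>I. x i * (u i \<bullet> u j) * x j)"
    unfolding w_def inner_sum_right by (intro sum.cong refl) simp
  finally show "0 \<le> (\<Sum>i\<in>I. \<Sum>j\<in>I. x i * (u i \<bullet> u j) * x j)" .
qed

lemma psd_on_gaussian:
  fixes u :: "'i \<Rightarrow> 'u::real_inner"
  assumes "finite I" "0 \<le> s"
  shows "psd_on I (\<lambda>i j. exp (- s * (norm (u i - u j))\<^sup>2))"
proof -
  define a where "a i = exp (- s * (norm (u i))\<^sup>2)" for i
  have "psd_on I (\<lambda>i j. a i * exp (2 * s * (u i \<bullet> u j)) * a j)"
    using assms by (intro psd_on_scale psd_on_exp psd_on_cmult psd_on_inner) (auto simp: inner_commute)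
  moreover have "a i * exp (2 * s * (u i \<bullet> u j)) * a j = exp (- s * (norm (u i - u j))\<^sup>2)" for i j
    by (simp add: a_def exp_add[symmetric] power2_norm_eq_inner inner_diff inner_commute
        algebra_simps)
  ultimately show ?thesis by simp
qed

lemma psd_on_has_integral:
  assumes "\<And>i j. i \<in> I \<Longrightarrow> j \<in> I \<Longrightarrow> ((\<lambda>s. g s i j) has_integral A i j) S"
    and "\<And>s. s \<in> S \<Longrightarrow> psd_on I (g s)" and "finite I"
  shows "psd_on I A"
proof (rule psd_onI)
  fix x
  have "((\<lambda>s. \<Sum>i\<in>I. \<Sum>j\<in>I. x i * g s i j * x j) has_integral
      (\<Sum>i\<in>I. \<Sum>j\<in>I. x i * A i j * x j)) S"
    by (intro has_integral_sum has_integral_mult_left has_integral_mult_right assms)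
  then show "0 \<le> (\<Sum>i\<in>I. \<Sum>j\<in>I. x i * A i j * x j)"
    by (rule has_integral_nonneg) (use assms(2) in \<open>auto intro: psd_onD\<close>)
qed

section \<open>Integral representations\<close>

text \<open>
  A multiple of the error function. The value \<open>sqrt pi / 2\<close> of its limit \<open>G\<close> is not needed.
\<close>

lemma gauss_primitive:
  obtains E :: "real \<Rightarrow> real" and G where
    "\<And>x. (E has_real_derivative exp (- x\<^sup>2)) (at x)" "E 0 = 0"
    "0 < G" "(E \<longlongrightarrow> G) at_top" "(E \<longlongrightarrow> - G) at_bot"
proof -
  have "\<exists>F. \<forall>x::real. - \<infinity> < ereal x \<longrightarrow> ereal x < \<infinity> \<longrightarrow> (F has_vector_derivative exp (- x\<^sup>2)) (at x)"
    by (rule einterval_antiderivative) (auto intro!: continuous_intros)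
  then obtain F where F: "\<And>x::real. (F has_real_derivative exp (- x\<^sup>2)) (at x)"
    by (auto simp: has_real_derivative_iff_has_vector_derivative)
  define E where "E x = F x - F 0" for x
  have dE: "(E has_real_derivative exp (- x\<^sup>2)) (at x)" for x
    unfolding E_def using F by (auto intro!: derivative_eq_intros)
  have E0: "E 0 = 0" by (simp add: E_def)
  have mono: "E x < E y" if "x < y" for x y
    using that by (rule DERIV_pos_imp_increasing) (use dE in force)
  have odd: "E (- x) = - E x" for x
  proof -
    have "((\<lambda>x. E (- x) + E x) has_real_derivative 0) (at x)" for x
      using dE by (auto intro!: derivative_eq_intros DERIV_chain2[OF dE])
    then have "E (- x) + E x = E (- 0) + E 0"
      using DERIV_isconst_all[of "\<lambda>x. E (- x) + E x" x 0] by blast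
    then show ?thesis by (simp add: E0)
  qed
  have bound: "E x \<le> pi / 2" for x
  proof (cases "x \<le> 0")
    case True
    then have "E x \<le> 0" using mono[of x 0] E0 by (cases "x = 0") auto
    then show ?thesis using pi_gt_zero by linarith
  next
    case False
    \<comment> \<open>\<open>arctan\<close> grows faster than \<open>E\<close> because \<open>exp (- t\<^sup>2) \<le> inverse (1 + t\<^sup>2)\<close>\<close>
    have "arctan 0 - E 0 \<le> arctan x - E x"
    proof (rule DERIV_nonneg_imp_nondecreasing[where f = "\<lambda>t. arctan t - E t"])
      fix t :: real
      have "1 + t\<^sup>2 \<le> exp (t\<^sup>2)" by (rule exp_ge_add_one_self)
      then have "exp (- t\<^sup>2) \<le> inverse (1 + t\<^sup>2)"
        by (simp add: exp_minus add_pos_nonneg le_imp_inverse_le)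
      moreover have "((\<lambda>t. arctan t - E t) has_real_derivative inverse (1 + t\<^sup>2) - exp (- t\<^sup>2)) (at t)"
        by (intro DERIV_diff DERIV_arctan dE)
      ultimately show "\<exists>y. ((\<lambda>t. arctan t - E t) has_real_derivative y) (at t) \<and> 0 \<le> y"
        by force
    qed (use False in auto)
    then show ?thesis using arctan_ubound[of x] E0 by simp
  qed
  define G where "G = (SUP x. E x)"
  have bdd: "bdd_above (range E)" using bound by (auto intro!: bdd_aboveI[of _ "pi / 2"])
  have le_G: "E x \<le> G" for x unfolding G_def by (rule cSUP_upper[OF _ bdd]) simp
  have "0 < G" using mono[of 0 1] E0 le_G[of 1] by simp
  moreover have top: "(E \<longlongrightarrow> G) at_top"
  proof (rule increasing_tendsto)
    fix a assume "a < G"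
    then obtain x where "a < E x"
      using less_cSUP_iff[OF _ bdd, of a] by (auto simp: G_def)
    then have "a < E y" if "y \<ge> x" for y
      using mono[of x y] that by (cases "x = y") auto
    then show "eventually (\<lambda>y. a < E y) at_top"
      unfolding eventually_at_top_linorder by blast
  qed (simp add: le_G)
  moreover have "(E \<longlongrightarrow> - G) at_bot"
    using tendsto_minus[OF top] by (simp add: at_bot_mirror filterlim_filtermap odd)
  ultimately show ?thesis using that dE E0 by blast
qed

text \<open>
  With \<open>2 * a = norm (u - v)\<close>, this presents the profile \<open>(1 + r) * exp (- r)\<close> as a mixture of
  Gaussians of inverse squared width \<open>1 / (4 * x\<^sup>2)\<close>. With \<open>h x = exp (- x\<^sup>2 - a\<^sup>2 / x\<^sup>2)\<close> and a
  primitive \<open>E\<close> of \<open>exp (- x\<^sup>2)\<close>, the functions \<open>exp (2 * a) * E (x + a / x)\<close> and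
  \<open>exp (- (2 * a)) * E (x - a / x)\<close> have the derivatives \<open>h x * (1 - a / x\<^sup>2)\<close> and
  \<open>h x * (1 + a / x\<^sup>2)\<close>, and together with \<open>x * h x\<close> they span an antiderivative of the integrand.
\<close>

lemma matern_mixture:
  obtains G :: real where "0 < G"
    "\<And>a. 0 \<le> a \<Longrightarrow> ((\<lambda>x. x\<^sup>2 * exp (- x\<^sup>2) * exp (- a\<^sup>2 / x\<^sup>2)) has_integral
        G * ((1 + 2 * a) * exp (- (2 * a)))) {0<..}"
proof -
  obtain E :: "real \<Rightarrow> real" and C where dE: "\<And>x. (E has_real_derivative exp (- x\<^sup>2)) (at x)"
    and E0: "E 0 = 0" and C: "0 < C" and top: "(E \<longlongrightarrow> C) at_top" and bot: "(E \<longlongrightarrow> - C) at_bot"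
    using gauss_primitive by blast
  have "((\<lambda>x. x\<^sup>2 * exp (- x\<^sup>2) * exp (- a\<^sup>2 / x\<^sup>2)) has_integral
        C / 2 * ((1 + 2 * a) * exp (- (2 * a)))) {0<..}" if a: "0 \<le> a" for a
  proof -
    define f where "f x = x\<^sup>2 * exp (- x\<^sup>2) * exp (- a\<^sup>2 / x\<^sup>2)" for x :: real
    define P where "P x = exp (2 * a) * E (x + a / x)" for x
    define Q where "Q x = exp (- (2 * a)) * E (x - a / x)" for x
    define h where "h x = exp (- x\<^sup>2) * exp (- a\<^sup>2 / x\<^sup>2)" for x :: real
    define F where "F x = - (x * h x / 2) + (P x + Q x) / 4 + a * (Q x - P x) / 2" for x
    have h: "exp (2 * a) * exp (- (x + a / x)\<^sup>2) = h x"
            "exp (- (2 * a)) * exp (- (x - a / x)\<^sup>2) = h x" if "x > 0" for x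
      using that by (simp_all add: h_def flip: exp_add) (simp_all add: field_simps power2_eq_square)
    have dh: "(h has_real_derivative h x * (2 * a\<^sup>2 / x ^ 3 - 2 * x)) (at x)" if "x > 0" for x
      unfolding h_def using that
      by (auto intro!: derivative_eq_intros simp: field_simps power2_eq_square power3_eq_cube)
    have dP: "(P has_real_derivative h x * (1 - a / x\<^sup>2)) (at x)" if "x > 0" for x
    proof -
      have "(P has_real_derivative exp (2 * a) * (exp (- (x + a / x)\<^sup>2) * (1 - a / x\<^sup>2))) (at x)"
        unfolding P_def using that
        by (auto intro!: derivative_eq_intros DERIV_chain2[OF dE] simp: power2_eq_square)
      then show ?thesis using h(1)[OF that] by (simp flip: mult.assoc)
    qed
    have dQ: "(Q has_real_derivative h x * (1 + a / x\<^sup>2)) (at x)" if "x > 0" for x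
    proof -
      have "(Q has_real_derivative exp (- (2 * a)) * (exp (- (x - a / x)\<^sup>2) * (1 + a / x\<^sup>2))) (at x)"
        unfolding Q_def using that
        by (auto intro!: derivative_eq_intros DERIV_chain2[OF dE] simp: power2_eq_square)
      then show ?thesis using h(2)[OF that] by (simp flip: mult.assoc)
    qed
    have dF: "(F has_real_derivative f x) (at x)" if "x > 0" for x
    proof -
      have "(F has_real_derivative
          - ((1 * h x + h x * (2 * a\<^sup>2 / x ^ 3 - 2 * x) * x) / 2)
          + (h x * (1 - a / x\<^sup>2) + h x * (1 + a / x\<^sup>2)) / 4
          + a * (h x * (1 + a / x\<^sup>2) - h x * (1 - a / x\<^sup>2)) / 2) (at x)"
        unfolding F_def
        by (intro DERIV_add DERIV_diff DERIV_minus DERIV_cdivide DERIV_cmult DERIV_mult DERIV_ident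
            dh dP dQ that)
      moreover have "- ((1 * h x + h x * (2 * a\<^sup>2 / x ^ 3 - 2 * x) * x) / 2)
          + (h x * (1 - a / x\<^sup>2) + h x * (1 + a / x\<^sup>2)) / 4
          + a * (h x * (1 + a / x\<^sup>2) - h x * (1 - a / x\<^sup>2)) / 2 = x\<^sup>2 * h x"
        using that by (simp add: field_simps power2_eq_square power3_eq_cube)
      moreover have "x\<^sup>2 * h x = f x" by (simp add: f_def h_def)
      ultimately show ?thesis by simp
    qed
    have h_bounds: "0 \<le> h x" "h x \<le> exp (- x\<^sup>2)" for x
      by (auto simp: h_def mult_le_cancel_left1)
    define e where "e = exp (2 * a)"
    define e' where "e' = exp (- (2 * a))"
    have lim0: "(F \<longlongrightarrow> C * (e - e') / 4 - a * (C * (e + e')) / 2) (at_right 0)"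
    proof -
      have "((\<lambda>x. x * h x) \<longlongrightarrow> 0) (at_right 0)"
      proof (rule tendsto_sandwich[of "\<lambda>_. 0"])
        show "((\<lambda>x::real. x) \<longlongrightarrow> 0) (at_right 0)" by (rule tendsto_ident_at)
        show "\<forall>\<^sub>F x in at_right 0. 0 \<le> x * h x"
          using eventually_at_right_less[of 0] by eventually_elim (simp add: h_bounds)
        show "\<forall>\<^sub>F x in at_right 0. x * h x \<le> x"
          using eventually_at_right_less[of 0]
        proof eventually_elim
          case (elim x)
          have "h x \<le> 1" using h_bounds(2)[of x] order_trans by fastforce
          then show ?case using elim by (simp add: mult_left_le)
        qed
      qed auto
      then have 1: "((\<lambda>x. x * h x / 2) \<longlongrightarrow> 0) (at_right 0)"
        by (auto intro: tendsto_eq_intros)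
      show ?thesis
      proof (cases "a = 0")
        case True
        \<comment> \<open>here \<open>x \<plusminus> a / x\<close> tends to \<open>0\<close>; for \<open>a > 0\<close> it tends to \<open>\<plusminus>\<infinity>\<close>\<close>
        have "isCont E 0" using dE DERIV_isCont by blast
        then have "(E \<longlongrightarrow> 0) (at_right 0)"
          using E0 by (simp add: isCont_def filterlim_at_split)
        then have "((\<lambda>x. - (x * h x / 2) + (E x + E x) / 4) \<longlongrightarrow> - 0 + (0 + 0) / 4) (at_right 0)"
          by (intro tendsto_intros 1) auto
        moreover have "F = (\<lambda>x. - (x * h x / 2) + (E x + E x) / 4)"
          using True by (simp add: fun_eq_iff F_def P_def Q_def)
        ultimately show ?thesis using True by (simp add: e_def e'_def)
      next
        case False
        then have "a > 0" using a by simp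
        then have inf: "filterlim (\<lambda>x. a / x) at_top (at_right 0)"
          using filterlim_tendsto_pos_mult_at_top[OF tendsto_const _ filterlim_inverse_at_top_right, of a]
          by (simp add: divide_inverse)
        have "filterlim (\<lambda>x. x + a / x) at_top (at_right 0)"
          by (rule filterlim_tendsto_add_at_top[OF tendsto_ident_at inf])
        then have P: "(P \<longlongrightarrow> e * C) (at_right 0)"
          unfolding P_def e_def by (intro tendsto_intros filterlim_compose[OF top])
        have "filterlim (\<lambda>x. - x + a / x) at_top (at_right 0)"
          by (rule filterlim_tendsto_add_at_top[OF tendsto_minus[OF tendsto_ident_at] inf])
        then have "filterlim (\<lambda>x. x - a / x) at_bot (at_right 0)"
          by (subst filterlim_uminus_at_bot) (simp add: algebra_simps)
        then have Q: "(Q \<longlongrightarrow> e' * (- C)) (at_right 0)"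
          unfolding Q_def e'_def by (intro tendsto_intros filterlim_compose[OF bot])
        have "(F \<longlongrightarrow> - 0 + (e * C + e' * (- C)) / 4 + a * (e' * (- C) - e * C) / 2) (at_right 0)"
          unfolding F_def by (intro tendsto_intros 1 P Q) auto
        then show ?thesis by (simp add: algebra_simps diff_divide_distrib add_divide_distrib)
      qed
    qed
    have lim_top: "(F \<longlongrightarrow> C * (e + e') / 4 + a * (C * (e' - e)) / 2) at_top"
    proof -
      have "((\<lambda>x. x * h x) \<longlongrightarrow> 0) at_top"
      proof (rule tendsto_sandwich[of "\<lambda>_. 0"])
        show "((\<lambda>x::real. inverse x) \<longlongrightarrow> 0) at_top" by (rule tendsto_inverse_0_at_top[OF filterlim_ident])
        show "\<forall>\<^sub>F x in at_top. 0 \<le> x * h x"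
          using eventually_gt_at_top[of 0] by eventually_elim (simp add: h_bounds)
        show "\<forall>\<^sub>F x in at_top. x * h x \<le> inverse x"
          using eventually_gt_at_top[of 0]
        proof eventually_elim
          case (elim x)
          have "x\<^sup>2 \<le> exp (x\<^sup>2)" using exp_ge_add_one_self[of "x\<^sup>2"] by linarith
          then have "exp (- x\<^sup>2) \<le> inverse (x\<^sup>2)"
            using elim by (simp add: exp_minus le_imp_inverse_le)
          then have "h x \<le> inverse (x\<^sup>2)" using h_bounds(2)[of x] by linarith
          then have "x * h x \<le> x * inverse (x\<^sup>2)" using elim by (intro mult_left_mono) auto
          then show ?case using elim by (simp add: field_simps power2_eq_square)
        qed
      qed auto
      then have 1: "((\<lambda>x. x * h x / 2) \<longlongrightarrow> 0) at_top"
        by (auto intro: tendsto_eq_intros)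
      have ax: "((\<lambda>x. a / x) \<longlongrightarrow> 0) at_top"
        by (rule tendsto_divide_0[OF tendsto_const filterlim_at_top_imp_at_infinity[OF filterlim_ident]])
      have "filterlim (\<lambda>x. x + a / x) at_top at_top"
        using filterlim_tendsto_add_at_top[OF ax filterlim_ident] by (simp add: add.commute)
      then have P: "(P \<longlongrightarrow> e * C) at_top"
        unfolding P_def e_def by (intro tendsto_intros filterlim_compose[OF top])
      have "filterlim (\<lambda>x. x - a / x) at_top at_top"
        using filterlim_tendsto_add_at_top[OF tendsto_minus[OF ax] filterlim_ident]
        by (simp add: add.commute)
      then have Q: "(Q \<longlongrightarrow> e' * C) at_top"
        unfolding Q_def e'_def by (intro tendsto_intros filterlim_compose[OF top])
      have "(F \<longlongrightarrow> - 0 + (e * C + e' * C) / 4 + a * (e' * C - e * C) / 2) at_top"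
        unfolding F_def by (intro tendsto_intros 1 P Q) auto
      then show ?thesis by (simp add: algebra_simps)
    qed
    have cont: "isCont f x" if "x > 0" for x
      unfolding f_def using that by (intro continuous_intros) auto
    have f_nonneg: "0 \<le> f x" for x by (simp add: f_def)
    note FTC = interval_integral_FTC_nonneg[of "ereal 0" \<infinity> F f]
    have ends: "((F \<circ> real_of_ereal) \<longlongrightarrow> C * (e - e') / 4 - a * (C * (e + e')) / 2) (at_right (ereal 0))"
        "((F \<circ> real_of_ereal) \<longlongrightarrow> C * (e + e') / 4 + a * (C * (e' - e)) / 2) (at_left \<infinity>)"
      using lim0 lim_top by (simp_all add: ereal_tendsto_simps)
    have "set_integrable lborel (einterval (ereal 0) \<infinity>) f"
      by (rule FTC(1)[OF _ _ _ _ ends]) (auto intro: dF cont simp: f_nonneg)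
    moreover have "(LBINT x=ereal 0..\<infinity>. f x)
        = (C * (e + e') / 4 + a * (C * (e' - e)) / 2) - (C * (e - e') / 4 - a * (C * (e + e')) / 2)"
      by (rule FTC(2)[OF _ _ _ _ ends]) (auto intro: dF cont simp: f_nonneg)
    moreover have "\<dots> = C / 2 * ((1 + 2 * a) * e')" by (simp add: field_simps)
    moreover have "einterval (ereal 0) \<infinity> = {0<..}" by (auto simp: einterval_def)
    ultimately have "(f has_integral C / 2 * ((1 + 2 * a) * e')) {0<..}"
      using set_borel_integral_eq_integral[of "{0<..}" f]
      by (simp add: interval_lebesgue_integral_def has_integral_iff)
    then show ?thesis by (simp add: f_def[abs_def] e'_def)
  qed
  then show ?thesis using C by (intro that[of "C / 2"]) auto
qed

text \<open>The Gamma integral after the substitution of \<open>a * s\<close> for the variable.\<close>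

lemma powr_mixture:
  fixes a d :: real
  assumes "0 < a" "0 < d"
  shows "((\<lambda>s. s powr (d - 1) * exp (- a * s)) has_integral Gamma d * a powr (- d)) {0<..}"
proof -
  have *: "((\<lambda>s. s powr (d - 1) / exp s) has_integral Gamma d) {0<..}"
    using Gamma_integral_real[OF assms(2)]
    by (subst (asm) has_integral_spike_set_eq[where T = "{0<..}"])
       (auto intro: negligible_subset[of "{0}"])
  have im: "(*) a ` {0<..} = {0<..}"
  proof -
    have "x \<in> (*) a ` {0<..}" if "x > 0" for x
      using that assms by (intro image_eqI[of _ _ "x / a"]) auto
    then show ?thesis using assms by auto
  qed
  have "(\<lambda>s. \<bar>a\<bar> * ((a * s) powr (d - 1) / exp (a * s))) absolutely_integrable_on {0<..} \<and>
      integral {0<..} (\<lambda>s. \<bar>a\<bar> * ((a * s) powr (d - 1) / exp (a * s))) = Gamma d"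
  proof (subst has_absolute_integral_change_of_variables_1'[where g = "(*) a" and g' = "\<lambda>_. a"])
    show "(\<lambda>s. s powr (d - 1) / exp s) absolutely_integrable_on (*) a ` {0<..} \<and>
        integral ((*) a ` {0<..}) (\<lambda>s. s powr (d - 1) / exp s) = Gamma d"
      unfolding im using * by (auto simp: has_integral_iff intro!: nonnegative_absolutely_integrable_1)
    show "((*) a has_real_derivative a) (at x within {0<..})" for x
      by (auto intro!: derivative_eq_intros)
    show "inj_on ((*) a) {0<..}" using assms by (auto simp: inj_on_def)
  qed auto
  then have "((\<lambda>s. a * ((a * s) powr (d - 1) / exp (a * s))) has_integral Gamma d) {0<..}"
    using assms absolutely_integrable_on_def by (auto simp: has_integral_iff)
  then have "((\<lambda>s. a powr (- d) * (a * ((a * s) powr (d - 1) / exp (a * s)))) has_integral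
      a powr (- d) * Gamma d) {0<..}"
    by (rule has_integral_mult_right)
  moreover have "a powr (- d) * (a * ((a * s) powr (d - 1) / exp (a * s))) = s powr (d - 1) * exp (- a * s)"
    if "s \<in> {0<..}" for s
    using that assms by (simp add: powr_mult powr_diff powr_minus exp_minus field_simps)
  ultimately have "((\<lambda>s. s powr (d - 1) * exp (- a * s)) has_integral a powr (- d) * Gamma d) {0<..}"
    by (rule has_integral_eq[rotated])
  then show ?thesis by (simp only: mult.commute)
qed

section \<open>Scalar kernels\<close>

lemma psd_scalar_kernelI:
  assumes "\<And>(n::nat) u. psd_on {1..n} (\<lambda>i j. k (u i) (u j))"
  shows "psd_kernel (scalar_kernel k)"
  using psd_onD[OF assms] by (simp add: psd_scalar_kernel_iff)

lemma psd_scalar_kernelD: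
  "psd_kernel (scalar_kernel k) \<Longrightarrow> psd_on {1..n::nat} (\<lambda>i j. k (u i) (u j))"
  by (simp add: psd_scalar_kernel_iff psd_on_def)

lemma nonexpansive_kernelI:
  assumes "\<And>u v. norm (K u u - K u v - K v u + K v v) \<le> (norm (u - v))\<^sup>2"
  shows "nonexpansive_kernel K"
  using assms by (simp add: nonexpansive_kernel_def real_le_lsqrt)

lemma nonexpansive_kernelD:
  "nonexpansive_kernel K \<Longrightarrow> norm (K u u - K u v - K v u + K v v) \<le> (norm (u - v))\<^sup>2"
  by (simp add: nonexpansive_kernel_def sqrt_le_D)

lemma nonexpansive_scalar_kernelD:
  "nonexpansive_kernel (scalar_kernel k) \<Longrightarrow> \<bar>k u u - k u v - k v u + k v v\<bar> \<le> (norm (u - v))\<^sup>2"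
  by (simp add: nonexpansive_scalar_kernel_iff sqrt_le_D)

text \<open>
  Here \<open>k u u - k u v - k v u + k v v = 2 * (\<phi> 0 - \<phi> (norm (u - v)))\<close>, so that nonexpansiveness
  is a bound on the deviation of the profile \<open>\<phi>\<close> from \<open>\<phi> 0\<close>.
\<close>

lemma radial_kernel_psd_nonexpansive:
  fixes \<phi> :: "real \<Rightarrow> real"
  assumes psd: "\<And>(n::nat) u :: nat \<Rightarrow> 'u::real_inner. psd_on {1..n} (\<lambda>i j. \<phi> (norm (u i - u j)))"
    and growth: "\<And>r. 0 \<le> r \<Longrightarrow> 2 * \<bar>\<phi> 0 - \<phi> r\<bar> \<le> r\<^sup>2"
  defines "k \<equiv> \<lambda>(u::'u) v. \<phi> (norm (u - v))"
  shows "symmetric_kernel (scalar_kernel k) \<and> psd_kernel (scalar_kernel k) \<and>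
    nonexpansive_kernel (scalar_kernel k)"
proof (intro conjI)
  show "symmetric_kernel (scalar_kernel k)"
    by (simp add: symmetric_scalar_kernel_iff k_def norm_minus_commute)
  show "psd_kernel (scalar_kernel k)"
    unfolding k_def by (intro psd_scalar_kernelI psd)
  show "nonexpansive_kernel (scalar_kernel k)"
    unfolding nonexpansive_scalar_kernel_iff
  proof (intro allI real_le_lsqrt)
    fix u v :: 'u
    have "k u u - k u v - k v u + k v v = 2 * (\<phi> 0 - \<phi> (norm (u - v)))"
      by (simp add: k_def norm_minus_commute)
    then show "\<bar>k u u - k u v - k v u + k v v\<bar> \<le> (norm (u - v))\<^sup>2"
      using growth[of "norm (u - v)"] by (simp only: abs_mult) simp
  qed auto
qed

lemma bilinear_kernel_psd_nonexpansive:
  "symmetric_kernel (scalar_kernel (\<bullet>)) \<and> psd_kernel (scalar_kernel (\<bullet>)) \<and>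
    nonexpansive_kernel (scalar_kernel ((\<bullet>) :: 'u::real_inner \<Rightarrow> 'u \<Rightarrow> real))"
proof (intro conjI)
  show "nonexpansive_kernel (scalar_kernel ((\<bullet>) :: 'u \<Rightarrow> 'u \<Rightarrow> real))"
    unfolding nonexpansive_scalar_kernel_iff
  proof (intro allI real_le_lsqrt)
    fix u v :: 'u
    have "u \<bullet> u - u \<bullet> v - v \<bullet> u + v \<bullet> v = (norm (u - v))\<^sup>2"
      by (simp add: power2_norm_eq_inner inner_diff)
    then show "\<bar>u \<bullet> u - u \<bullet> v - v \<bullet> u + v \<bullet> v\<bar> \<le> (norm (u - v))\<^sup>2" by simp
  qed auto
qed (auto simp: symmetric_scalar_kernel_iff inner_commute intro!: psd_scalar_kernelI psd_on_inner)

lemma gaussian_kernel_psd_nonexpansive: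
  fixes \<sigma> :: real
  assumes "sqrt 2 \<le> \<sigma>"
  defines "k \<equiv> \<lambda>(u::'u::real_inner) v. exp (- (norm (u - v))\<^sup>2 / \<sigma>\<^sup>2)"
  shows "symmetric_kernel (scalar_kernel k) \<and> psd_kernel (scalar_kernel k) \<and>
    nonexpansive_kernel (scalar_kernel k)"
  unfolding k_def
proof (rule radial_kernel_psd_nonexpansive[where \<phi> = "\<lambda>r. exp (- r\<^sup>2 / \<sigma>\<^sup>2)"])
  show "psd_on {1..n} (\<lambda>i j. exp (- (norm (u i - u j))\<^sup>2 / \<sigma>\<^sup>2))" for n :: nat and u :: "nat \<Rightarrow> 'u"
    using psd_on_gaussian[of "{1..n}" "1 / \<sigma>\<^sup>2" u] by simp
next
  fix r :: real
  have "(sqrt 2)\<^sup>2 \<le> \<sigma>\<^sup>2" using assms by (intro power_mono) auto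
  then have \<sigma>: "2 \<le> \<sigma>\<^sup>2" by simp
  have "2 * (1 - exp (- r\<^sup>2 / \<sigma>\<^sup>2)) \<le> 2 * (r\<^sup>2 / \<sigma>\<^sup>2)"
    using exp_ge_add_one_self[of "- r\<^sup>2 / \<sigma>\<^sup>2"] by simp
  also have "2 * (r\<^sup>2 / \<sigma>\<^sup>2) \<le> r\<^sup>2"
    using \<sigma> mult_right_mono[OF \<sigma>, of "r\<^sup>2"] by (simp add: divide_le_eq mult.commute)
  finally show "2 * \<bar>exp (- 0\<^sup>2 / \<sigma>\<^sup>2) - exp (- r\<^sup>2 / \<sigma>\<^sup>2)\<bar> \<le> r\<^sup>2"
    by simp
qed

lemma laplacian_kernel_psd_nonexpansive:
  defines "k \<equiv> \<lambda>(u::'u::real_inner) v. (1 + norm (u - v)) * exp (- norm (u - v))"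
  shows "symmetric_kernel (scalar_kernel k) \<and> psd_kernel (scalar_kernel k) \<and>
    nonexpansive_kernel (scalar_kernel k)"
  unfolding k_def
proof (rule radial_kernel_psd_nonexpansive[where \<phi> = "\<lambda>r. (1 + r) * exp (- r)"])
  fix n :: nat and u :: "nat \<Rightarrow> 'u"
  let ?\<phi> = "\<lambda>i j. (1 + norm (u i - u j)) * exp (- norm (u i - u j))"
  \<comment> \<open>the mixture is used at \<open>a = norm (u i - u j) / 2\<close>\<close>
  obtain G :: real where G: "0 < G" and mix:
    "\<And>a. 0 \<le> a \<Longrightarrow> ((\<lambda>x. x\<^sup>2 * exp (- x\<^sup>2) * exp (- a\<^sup>2 / x\<^sup>2)) has_integral
        G * ((1 + 2 * a) * exp (- (2 * a)))) {0<..}"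
    using matern_mixture by blast
  have "psd_on {1..n} (\<lambda>i j. G * ?\<phi> i j)"
  proof (rule psd_on_has_integral)
    show "((\<lambda>x. x\<^sup>2 * exp (- x\<^sup>2) * exp (- (1 / (4 * x\<^sup>2)) * (norm (u i - u j))\<^sup>2)) has_integral
        G * ?\<phi> i j) {0<..}" for i j
      using mix[of "norm (u i - u j) / 2"] by (simp add: power_divide)
    show "psd_on {1..n} (\<lambda>i j. x\<^sup>2 * exp (- x\<^sup>2) * exp (- (1 / (4 * x\<^sup>2)) * (norm (u i - u j))\<^sup>2))"
      for x :: real
      by (intro psd_on_cmult psd_on_gaussian) auto
  qed auto
  from psd_on_cmult[OF this, of "1 / G"] G show "psd_on {1..n} ?\<phi>" by simp
next
  fix r :: real assume r: "0 \<le> r"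
  have der: "((\<lambda>r. (1 + r) * exp (- r)) has_real_derivative - x * exp (- x)) (at x)" for x :: real
    by (auto intro!: derivative_eq_intros simp: algebra_simps)
  have "(1 + r) * exp (- r) \<le> (1 + 0) * exp (- 0)"
    by (rule DERIV_nonpos_imp_nonincreasing[OF r, where f = "\<lambda>r. (1 + r) * exp (- r)"])
       (use der in \<open>force intro!: mult_nonneg_nonneg\<close>)
  \<comment> \<open>the difference of the two sides has the derivative \<open>r * (1 - exp (- r))\<close>\<close>
  moreover have "(1 + 0) * exp (- 0) + 0\<^sup>2 / 2 \<le> (1 + r) * exp (- r) + r\<^sup>2 / 2"
  proof (rule DERIV_nonneg_imp_nondecreasing[OF r, where f = "\<lambda>r. (1 + r) * exp (- r) + r\<^sup>2 / 2"])
    fix x :: real assume "0 \<le> x"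
    have "((\<lambda>r. (1 + r) * exp (- r) + r\<^sup>2 / 2) has_real_derivative - x * exp (- x) + x) (at x)"
      by (rule DERIV_add[OF der]) (auto intro!: derivative_eq_intros)
    moreover have "0 \<le> x * (1 - exp (- x))" using \<open>0 \<le> x\<close> by simp
    ultimately show "\<exists>y. ((\<lambda>r. (1 + r) * exp (- r) + r\<^sup>2 / 2) has_real_derivative y) (at x) \<and> 0 \<le> y"
      by (intro exI[of _ "- x * exp (- x) + x"]) (simp add: algebra_simps)
  qed
  ultimately show "2 * \<bar>(1 + 0) * exp (- 0) - (1 + r) * exp (- r)\<bar> \<le> r\<^sup>2" by simp
qed

lemma inverse_multiquadric_kernel_psd_nonexpansive:
  fixes c d :: real
  assumes "0 \<le> c" "0 < d" and cd: "2 * d \<le> c powr (d + 1)"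
  defines "k \<equiv> \<lambda>(u::'u::real_inner) v. (c + (norm (u - v))\<^sup>2) powr (- d)"
  shows "symmetric_kernel (scalar_kernel k) \<and> psd_kernel (scalar_kernel k) \<and>
    nonexpansive_kernel (scalar_kernel k)"
  unfolding k_def
proof (rule radial_kernel_psd_nonexpansive[where \<phi> = "\<lambda>r. (c + r\<^sup>2) powr (- d)"])
  \<comment> \<open>\<open>c = 0\<close> is excluded by \<open>2 * d \<le> c powr (d + 1)\<close>, since \<open>0 powr (d + 1) = 0\<close>\<close>
  have c: "0 < c" using assms by (cases "c = 0") auto
  {
    fix n :: nat and u :: "nat \<Rightarrow> 'u"
    let ?\<phi> = "\<lambda>i j. (c + (norm (u i - u j))\<^sup>2) powr (- d)"
    have "psd_on {1..n} (\<lambda>i j. Gamma d * ?\<phi> i j)"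
    proof (rule psd_on_has_integral)
      show "((\<lambda>s. s powr (d - 1) * exp (- c * s) * exp (- s * (norm (u i - u j))\<^sup>2)) has_integral
          Gamma d * ?\<phi> i j) {0<..}" for i j
      proof -
        have "exp (- (c + (norm (u i - u j))\<^sup>2) * s) = exp (- c * s) * exp (- s * (norm (u i - u j))\<^sup>2)"
          for s :: real
          by (simp add: algebra_simps flip: exp_add)
        then show ?thesis
          using powr_mixture[OF add_pos_nonneg[OF c zero_le_power2] \<open>0 < d\<close>, of "norm (u i - u j)"]
          by (simp only: mult.assoc)
      qed
      show "psd_on {1..n} (\<lambda>i j. s powr (d - 1) * exp (- c * s) * exp (- s * (norm (u i - u j))\<^sup>2))"
        if "s \<in> {0<..}" for s
        using that by (intro psd_on_cmult psd_on_gaussian) auto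
    qed auto
    from psd_on_cmult[OF this, of "1 / Gamma d"] show "psd_on {1..n} ?\<phi>"
      using Gamma_real_pos[OF \<open>0 < d\<close>] by simp
  }
  fix r :: real
  \<comment> \<open>the convex function \<open>t \<mapsto> (c + t) powr (- d)\<close> lies above its tangent at \<open>0\<close>\<close>
  have "(c + 0) powr (- d) + d * c powr (- d - 1) * 0
      \<le> (c + r\<^sup>2) powr (- d) + d * c powr (- d - 1) * r\<^sup>2"
  proof (rule DERIV_nonneg_imp_nondecreasing
      [where f = "\<lambda>t. (c + t) powr (- d) + d * c powr (- d - 1) * t"])
    fix t :: real assume t: "0 \<le> t"
    have "((\<lambda>t. (c + t) powr (- d) + d * c powr (- d - 1) * t) has_real_derivative
        - d * (c + t) powr (- d - 1) + d * c powr (- d - 1)) (at t)"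
      using c t by (auto intro!: derivative_eq_intros simp: powr_diff)
    moreover have "(c + t) powr (- d - 1) \<le> c powr (- d - 1)"
      using c t assms by (intro powr_mono2') auto
    then have "d * (c + t) powr (- d - 1) \<le> d * c powr (- d - 1)"
      using assms by (intro mult_left_mono) auto
    ultimately show "\<exists>y. ((\<lambda>t. (c + t) powr (- d) + d * c powr (- d - 1) * t)
        has_real_derivative y) (at t) \<and> 0 \<le> y"
      by (intro exI[of _ "- d * (c + t) powr (- d - 1) + d * c powr (- d - 1)"]) simp
  qed auto
  moreover have "2 * (d * c powr (- d - 1) * r\<^sup>2) \<le> r\<^sup>2"
  proof -
    have "2 * d * c powr (- d - 1) \<le> c powr (d + 1) * c powr (- d - 1)"
      by (intro mult_right_mono cd) auto
    also have "\<dots> = 1" using c by (simp flip: powr_add)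
    finally show ?thesis
      using mult_right_mono[of "2 * d * c powr (- d - 1)" 1 "r\<^sup>2"] by (simp add: mult.assoc)
  qed
  moreover have "(c + r\<^sup>2) powr (- d) \<le> c powr (- d)"
    using c assms by (intro powr_mono2') auto
  ultimately show "2 * \<bar>(c + 0\<^sup>2) powr (- d) - (c + r\<^sup>2) powr (- d)\<bar> \<le> r\<^sup>2" by simp
qed

section \<open>Operator-valued kernels\<close>

lemma adj_blinfun_eqI:
  fixes R :: "'a::{real_inner, complete_space} \<Rightarrow>\<^sub>L 'b::real_inner"
  assumes "\<And>x y. blinfun_apply R x \<bullet> y = x \<bullet> blinfun_apply S y"
  shows "adj_blinfun R = S"
proof (rule blinfun_eqI)
  fix y
  have "x \<bullet> blinfun_apply (adj_blinfun R) y = x \<bullet> blinfun_apply S y" for x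
    using inner_adj_blinfun[of R x y] assms[of x y] by simp
  then show "blinfun_apply (adj_blinfun R) y = blinfun_apply S y"
    using vector_eq_ldot by blast
qed

lemma norm_adj_blinfun_le:
  fixes R :: "'a::{real_inner, complete_space} \<Rightarrow>\<^sub>L 'b::real_inner"
  shows "norm (adj_blinfun R) \<le> norm R"
proof (rule norm_blinfun_bound)
  fix y
  let ?z = "blinfun_apply (adj_blinfun R) y"
  have "norm ?z * norm ?z = blinfun_apply R ?z \<bullet> y"
    by (simp add: inner_adj_blinfun flip: power2_norm_eq_inner power2_eq_square)
  also have "\<dots> \<le> norm (blinfun_apply R ?z) * norm y" by (rule norm_cauchy_schwarz)
  also have "\<dots> \<le> (norm R * norm ?z) * norm y"
    by (intro mult_right_mono norm_blinfun) auto
  finally show "norm ?z \<le> norm R * norm y"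
    by (cases "?z = 0") (auto simp: mult.commute mult.left_commute)
qed simp

lemma scaled_operator_kernel_psd_nonexpansive:
  fixes k :: "'u::real_normed_vector \<Rightarrow> 'u \<Rightarrow> real" and R :: "'y::{real_inner, complete_space} \<Rightarrow>\<^sub>L 'y"
  assumes k: "symmetric_kernel (scalar_kernel k)" "psd_kernel (scalar_kernel k)"
      "nonexpansive_kernel (scalar_kernel k)"
    and R: "adj_blinfun R = R" "positive_op R" "norm R \<le> 1"
  defines "K \<equiv> \<lambda>u v. k u v *\<^sub>R R"
  shows "symmetric_kernel K \<and> psd_kernel K \<and> nonexpansive_kernel K"
proof (intro conjI)
  have sym: "k u v = k v u" for u v
    using k(1) by (simp add: symmetric_scalar_kernel_iff)
  have "adj_blinfun (K u v) = K v u" for u v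
  proof (rule adj_blinfun_eqI)
    show "blinfun_apply (K u v) x \<bullet> y = x \<bullet> blinfun_apply (K v u) y" for x y
      using inner_adj_blinfun[of R x y] by (simp add: K_def R(1) sym[of u v] blinfun.scaleR_left)
  qed
  then show "symmetric_kernel K" by (simp add: symmetric_kernel_def)
  show "psd_kernel K"
    unfolding psd_kernel_def
  proof (intro allI)
    fix n :: nat and u :: "nat \<Rightarrow> 'u" and y :: "nat \<Rightarrow> 'y"
    let ?I = "{1..n}"
    \<comment> \<open>a factorization of the scalar matrix splits the form into terms \<open>w m \<bullet> R (w m)\<close>\<close>
    obtain f where f: "\<And>i j. i \<in> ?I \<Longrightarrow> j \<in> ?I \<Longrightarrow> k (u i) (u j) = (\<Sum>m\<in>?I. f m i * f m j)"
      using psd_on_factorization[OF _ psd_scalar_kernelD[OF k(2)], of n u] sym by blast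
    define w where "w m = (\<Sum>j\<in>?I. f m j *\<^sub>R y j)" for m
    have wRw: "w m \<bullet> blinfun_apply R (w m) =
        (\<Sum>i\<in>?I. \<Sum>j\<in>?I. f m i * f m j * (y i \<bullet> blinfun_apply R (y j)))" for m
    proof -
      have "w m \<bullet> blinfun_apply R (w m) = (\<Sum>i\<in>?I. f m i *\<^sub>R y i \<bullet> blinfun_apply R (w m))"
        by (subst (1) w_def) (rule inner_sum_left)
      also have "\<dots> = (\<Sum>i\<in>?I. \<Sum>j\<in>?I. f m i * f m j * (y i \<bullet> blinfun_apply R (y j)))"
        unfolding w_def blinfun.sum_right inner_sum_right
        by (intro sum.cong refl) (simp add: blinfun.scaleR_right)
      finally show ?thesis .
    qed
    have "0 \<le> (\<Sum>m\<in>?I. w m \<bullet> blinfun_apply R (w m))"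
      using R(2) by (intro sum_nonneg) (simp add: positive_op_def)
    also have "\<dots> = (\<Sum>i\<in>?I. \<Sum>m\<in>?I. \<Sum>j\<in>?I. f m i * f m j * (y i \<bullet> blinfun_apply R (y j)))"
      unfolding wRw by (rule sum.swap)
    also have "\<dots> = (\<Sum>i\<in>?I. \<Sum>j\<in>?I. \<Sum>m\<in>?I. f m i * f m j * (y i \<bullet> blinfun_apply R (y j)))"
      by (intro sum.cong refl sum.swap)
    also have "\<dots> = (\<Sum>i\<in>?I. \<Sum>j\<in>?I. y i \<bullet> blinfun_apply (K (u i) (u j)) (y j))"
      by (intro sum.cong refl) (simp add: K_def blinfun.scaleR_left f sum_distrib_right)
    finally show "0 \<le> (\<Sum>i\<in>?I. \<Sum>j\<in>?I. y i \<bullet> blinfun_apply (K (u i) (u j)) (y j))" .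
  qed
  show "nonexpansive_kernel K"
  proof (rule nonexpansive_kernelI)
    fix u v
    have "K u u - K u v - K v u + K v v = (k u u - k u v - k v u + k v v) *\<^sub>R R"
      by (simp add: K_def scaleR_diff_left scaleR_add_left)
    then have "norm (K u u - K u v - K v u + K v v) \<le> \<bar>k u u - k u v - k v u + k v v\<bar>"
      using R(3) by (simp add: mult_left_le)
    also have "\<dots> \<le> (norm (u - v))\<^sup>2" by (rule nonexpansive_scalar_kernelD[OF k(3)])
    finally show "norm (K u u - K u v - K v u + K v v) \<le> (norm (u - v))\<^sup>2" .
  qed
qed

lemma subconvex_combination_kernel_psd_nonexpansive:
  fixes Ks :: "'i \<Rightarrow> 'u::real_normed_vector \<Rightarrow> 'u \<Rightarrow> 'y::{real_inner, complete_space} \<Rightarrow>\<^sub>L 'y"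
  assumes K: "\<And>i. i \<in> I \<Longrightarrow> symmetric_kernel (Ks i)" "\<And>i. i \<in> I \<Longrightarrow> psd_kernel (Ks i)"
      "\<And>i. i \<in> I \<Longrightarrow> nonexpansive_kernel (Ks i)"
    and \<alpha>: "\<And>i. i \<in> I \<Longrightarrow> 0 \<le> \<alpha> i" "(\<Sum>i\<in>I. \<alpha> i) \<le> 1"
  defines "K \<equiv> \<lambda>u v. \<Sum>i\<in>I. \<alpha> i *\<^sub>R Ks i u v"
  shows "symmetric_kernel K \<and> psd_kernel K \<and> nonexpansive_kernel K"
proof (intro conjI)
  have K_apply: "blinfun_apply (K u v) x = (\<Sum>i\<in>I. \<alpha> i *\<^sub>R blinfun_apply (Ks i u v) x)" for u v x
    by (simp add: K_def blinfun.sum_left blinfun.scaleR_left)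
  have "adj_blinfun (K u v) = K v u" for u v
  proof (rule adj_blinfun_eqI)
    fix x y
    have "blinfun_apply (Ks i u v) x \<bullet> y = x \<bullet> blinfun_apply (Ks i v u) y" if "i \<in> I" for i
      using K(1)[OF that] inner_adj_blinfun[of "Ks i u v" x y] by (simp add: symmetric_kernel_def)
    then show "blinfun_apply (K u v) x \<bullet> y = x \<bullet> blinfun_apply (K v u) y"
      by (simp add: K_apply inner_sum_left inner_sum_right)
  qed
  then show "symmetric_kernel K" by (simp add: symmetric_kernel_def)
  show "psd_kernel K"
    unfolding psd_kernel_def
  proof (intro allI)
    fix n :: nat and u :: "nat \<Rightarrow> 'u" and y :: "nat \<Rightarrow> 'y"
    let ?q = "\<lambda>m i j. y i \<bullet> blinfun_apply (Ks m (u i) (u j)) (y j)"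
    have "0 \<le> (\<Sum>m\<in>I. \<alpha> m * (\<Sum>i=1..n. \<Sum>j=1..n. ?q m i j))"
    proof (rule sum_nonneg)
      fix m assume "m \<in> I"
      then show "0 \<le> \<alpha> m * (\<Sum>i=1..n. \<Sum>j=1..n. ?q m i j)"
        using K(2) \<alpha>(1) unfolding psd_kernel_def by (intro mult_nonneg_nonneg) blast+
    qed
    also have "\<dots> = (\<Sum>m\<in>I. \<Sum>i=1..n. \<Sum>j=1..n. \<alpha> m * ?q m i j)"
      by (simp only: sum_distrib_left)
    also have "\<dots> = (\<Sum>i=1..n. \<Sum>m\<in>I. \<Sum>j=1..n. \<alpha> m * ?q m i j)" by (rule sum.swap)
    also have "\<dots> = (\<Sum>i=1..n. \<Sum>j=1..n. \<Sum>m\<in>I. \<alpha> m * ?q m i j)"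
      by (intro sum.cong refl sum.swap)
    also have "\<dots> = (\<Sum>i=1..n. \<Sum>j=1..n. y i \<bullet> blinfun_apply (K (u i) (u j)) (y j))"
      by (simp add: K_apply inner_sum_right)
    finally show "0 \<le> (\<Sum>i=1..n. \<Sum>j=1..n. y i \<bullet> blinfun_apply (K (u i) (u j)) (y j))" .
  qed
  show "nonexpansive_kernel K"
  proof (rule nonexpansive_kernelI)
    fix u v
    let ?D = "\<lambda>i. Ks i u u - Ks i u v - Ks i v u + Ks i v v"
    have "K u u - K u v - K v u + K v v = (\<Sum>i\<in>I. \<alpha> i *\<^sub>R ?D i)"
      by (simp add: K_def scaleR_diff_right scaleR_add_right sum.distrib sum_subtractf)
    also have "norm \<dots> \<le> (\<Sum>i\<in>I. norm (\<alpha> i *\<^sub>R ?D i))" by (rule norm_sum)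
    also have "\<dots> \<le> (\<Sum>i\<in>I. \<alpha> i * (norm (u - v))\<^sup>2)"
      using K(3) \<alpha>(1) by (intro sum_mono) (auto intro!: mult_left_mono nonexpansive_kernelD)
    also have "\<dots> = (\<Sum>i\<in>I. \<alpha> i) * (norm (u - v))\<^sup>2" by (rule sum_distrib_right[symmetric])
    also have "\<dots> \<le> 1 * (norm (u - v))\<^sup>2" by (intro mult_right_mono \<alpha>(2)) auto
    finally show "norm (K u u - K u v - K v u + K v v) \<le> (norm (u - v))\<^sup>2" by simp
  qed
qed

text \<open>
  Since \<open>R L(u, v) R\<^sup>* = L(u, v) R R\<^sup>*\<close>, this is
  \<open>scaled_operator_kernel_psd_nonexpansive\<close> for the self-adjoint positive operator \<open>R R\<^sup>*\<close>, of norm at most \<open>1\<close>.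
\<close>

lemma sandwiched_kernel_psd_nonexpansive:
  fixes L :: "'u::real_normed_vector \<Rightarrow> 'u \<Rightarrow> real" and R :: "'y::{real_inner, complete_space} \<Rightarrow>\<^sub>L 'y"
  assumes L: "symmetric_kernel (scalar_kernel L)" "psd_kernel (scalar_kernel L)"
      "nonexpansive_kernel (scalar_kernel L)"
    and R: "norm R \<le> 1"
  defines "K \<equiv> \<lambda>u v. R o\<^sub>L scalar_op (L u v) o\<^sub>L adj_blinfun R"
  shows "symmetric_kernel K \<and> psd_kernel K \<and> nonexpansive_kernel K"
proof -
  let ?S = "R o\<^sub>L adj_blinfun R"
  have adj: "blinfun_apply (adj_blinfun R) x \<bullet> y = x \<bullet> blinfun_apply R y" for x y
    by (metis inner_adj_blinfun inner_commute)
  have "K = (\<lambda>u v. L u v *\<^sub>R ?S)"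
    by (intro ext blinfun_eqI) (simp add: K_def blinfun.scaleR_left blinfun.scaleR_right)
  moreover have "adj_blinfun ?S = ?S"
    by (rule adj_blinfun_eqI) (simp flip: adj, rule inner_adj_blinfun)
  moreover have "positive_op ?S"
    by (simp add: positive_op_def flip: adj)
  moreover have "norm ?S \<le> 1"
  proof -
    have "norm ?S \<le> norm R * norm (adj_blinfun R)" by (rule norm_blinfun_compose)
    also have "\<dots> \<le> 1 * 1"
      using R norm_adj_blinfun_le[of R] by (intro mult_mono) auto
    finally show ?thesis by simp
  qed
  ultimately show ?thesis using scaled_operator_kernel_psd_nonexpansive[OF L, of ?S] by simp
qed

theorem proposition9:
  shows
    "(let k = (\<lambda>(u::'u::{real_inner, complete_space}) v. u \<bullet> v)
      in symmetric_kernel (scalar_kernel k) \<and> psd_kernel (scalar_kernel k) \<and>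
         nonexpansive_kernel (scalar_kernel k))
     \<and>
     (\<forall>\<sigma>::real. \<sigma> \<ge> sqrt 2 \<longrightarrow>
       (let k = (\<lambda>(u::'u) v. exp (- (norm (u - v))\<^sup>2 / \<sigma>\<^sup>2))
        in symmetric_kernel (scalar_kernel k) \<and> psd_kernel (scalar_kernel k) \<and>
           nonexpansive_kernel (scalar_kernel k)))
     \<and>
     (let k = (\<lambda>(u::'u) v. (1 + norm (u - v)) * exp (- norm (u - v)))
      in symmetric_kernel (scalar_kernel k) \<and> psd_kernel (scalar_kernel k) \<and>
         nonexpansive_kernel (scalar_kernel k))
     \<and>
     (\<forall>c d::real. c \<ge> 0 \<longrightarrow> d > 0 \<longrightarrow> 2 * d \<le> c powr (d + 1) \<longrightarrow>
       (let k = (\<lambda>(u::'u) v. (c + (norm (u - v))\<^sup>2) powr (- d))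
        in symmetric_kernel (scalar_kernel k) \<and> psd_kernel (scalar_kernel k) \<and>
           nonexpansive_kernel (scalar_kernel k)))
     \<and>
     (\<forall>(k :: 'u \<Rightarrow> 'u \<Rightarrow> real) (R :: 'y::{real_inner, complete_space} \<Rightarrow>\<^sub>L 'y).
       symmetric_kernel (scalar_kernel k) \<longrightarrow> psd_kernel (scalar_kernel k) \<longrightarrow>
       nonexpansive_kernel (scalar_kernel k) \<longrightarrow>
       adj_blinfun R = R \<longrightarrow> positive_op R \<longrightarrow> norm R \<le> 1 \<longrightarrow>
       (let K = (\<lambda>u v. k u v *\<^sub>R R)
        in symmetric_kernel K \<and> psd_kernel K \<and> nonexpansive_kernel K))
     \<and>
     (\<forall>(r::nat) (\<alpha> :: nat \<Rightarrow> real) (Ks :: nat \<Rightarrow> 'u \<Rightarrow> 'u \<Rightarrow> 'y \<Rightarrow>\<^sub>L 'y).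
       (\<forall>i\<in>{1..r}. nonexpansive_kernel (Ks i) \<and> symmetric_kernel (Ks i) \<and> psd_kernel (Ks i) \<and>
          \<alpha> i \<ge> 0) \<longrightarrow>
       (\<Sum>i=1..r. \<alpha> i) \<le> 1 \<longrightarrow>
       (let K = (\<lambda>u v. \<Sum>i=1..r. \<alpha> i *\<^sub>R Ks i u v)
        in symmetric_kernel K \<and> psd_kernel K \<and> nonexpansive_kernel K))
     \<and>
     (\<forall>(L :: 'u \<Rightarrow> 'u \<Rightarrow> real) (R :: 'y \<Rightarrow>\<^sub>L 'y).
       symmetric_kernel (scalar_kernel L) \<longrightarrow> psd_kernel (scalar_kernel L) \<longrightarrow>
       nonexpansive_kernel (scalar_kernel L) \<longrightarrow>
       norm R \<le> 1 \<longrightarrow>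
       (let K = (\<lambda>u v. R o\<^sub>L scalar_op (L u v) o\<^sub>L adj_blinfun R)
        in symmetric_kernel K \<and> psd_kernel K \<and> nonexpansive_kernel K))"
  unfolding Let_def
proof (intro conjI[OF bilinear_kernel_psd_nonexpansive conjI[OF _
    conjI[OF laplacian_kernel_psd_nonexpansive conjI[OF _ conjI[OF _ conjI]]]]] allI impI)
qed (rule gaussian_kernel_psd_nonexpansive inverse_multiquadric_kernel_psd_nonexpansive
    scaled_operator_kernel_psd_nonexpansive subconvex_combination_kernel_psd_nonexpansive
    sandwiched_kernel_psd_nonexpansive; simp)+

end
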